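(* Let $G$ be a finite loopless graph (directed or undirected) with vertex set $\{1,\dots,n\}$ and edge (arc) set $E$, and let $H$ be its conflict graph. (i) A subgraph $T$ of $G$ with vertex set $\{1,\dots,n\}$ is a maximal projective subgraph of $G$ if and only if the edge set of $T$ is a maximal (by inclusion) independent set of vertices of $H$. (ii) The projective spanning trees of $G$ are exactly the spanning trees of the maximal projective subgraphs of $G$. That is, a subgraph of $G$ is a projective spanning tree of $G$ if and only if it is a spanning tree of some maximal projective subgraph of $G$. In the directed case, for every vertex $r$, the same holds with "spanning tree" replaced by "directed spanning tree rooted at $r$".
   Context: To each edge or arc $e$ of $G$ associate the pair $\{\underline{m},\overline{m}\}$, $\underline{m}<\overline{m}$, of its end vertices (ignoring direction). Two edges with associated pairs $\{\underline{m},\overline{m}\}$ and $\{\underline{l},\overline{l}\}$ are in conflict if the open intervals $(\underline{m},\overline{m})$ and $(\underline{l},\overline{l})$ have a non-empty intersection different from both intervals; equivalently $\underline{m}<\underline{l}<\overline{m}<\overline{l}$ or $\underline{l}<\underline{m}<\overline{l}<\overline{m}$. The conflict graph $H$ of $G$ is the undirected graph whose vertex set is $E$ and whose edges are exactly the pairs of conflicting edges of $G$. A subgraph $T$ of $G$ is a maximal projective subgraph of $G$ if (a) its vertex set equals that of $G$; (b) no two edges of $T$ are in conflict; (c) every edge of $G$ not in $T$ is in conflict with at least one edge of $T$. A spanning tree (or directed spanning tree) is projective if no two of its edges are in conflict. A directed spanning tree rooted at $r$ is a spanning subgraph that is a tree with all arcs oriented away from $r$. *)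

theory Defs
  imports Complex_Main "Graph_Theory.Digraph_Component"
begin

section \<open>Undirected multigraphs\<close>

text \<open>
  Directed graphs are the multidigraphs of the Graph-Theory library, with its notions of
  subgraph and spanning subgraph. That library models undirected graphs as symmetric digraphs,
  where an edge together with its reverse already counts as a cycle, and its \<open>forest\<close> only
  excludes directed cycles; so its \<open>tree\<close> is not the usual notion, neither for undirected graphs
  nor for the graph underlying a digraph. Undirected graphs, possibly with parallel edges, are
  therefore represented separately, by the set of end vertices of each edge.
\<close>

record ('a, 'e) ugraph =
  uverts :: "'a set"
  uedges :: "'e set"
  uends  :: "'e \<Rightarrow> 'a set"

definition wf_ugraph :: "('a, 'e) ugraph \<Rightarrow> bool" where
  "wf_ugraph G \<longleftrightarrow>
     (\<forall>e\<in>uedges G. uends G e \<subseteq> uverts G \<and> (card (uends G e) = 1 \<or> card (uends G e) = 2))"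

definition finite_ugraph :: "('a, 'e) ugraph \<Rightarrow> bool" where
  "finite_ugraph G \<longleftrightarrow> wf_ugraph G \<and> finite (uverts G) \<and> finite (uedges G)"

definition loopless_ugraph :: "('a, 'e) ugraph \<Rightarrow> bool" where
  "loopless_ugraph G \<longleftrightarrow> wf_ugraph G \<and> (\<forall>e\<in>uedges G. card (uends G e) = 2)"

text \<open>
  As for the library's \<open>subgraph\<close>, the end-vertex functions have to agree as total functions, so a
  subgraph is determined by its vertex set and its edge set.
\<close>

definition usubgraph :: "('a, 'e) ugraph \<Rightarrow> ('a, 'e) ugraph \<Rightarrow> bool" where
  "usubgraph T G \<longleftrightarrow> wf_ugraph G \<and> wf_ugraph T \<and>
     uverts T \<subseteq> uverts G \<and> uedges T \<subseteq> uedges G \<and> uends T = uends G"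

definition uspanning :: "('a, 'e) ugraph \<Rightarrow> ('a, 'e) ugraph \<Rightarrow> bool" where
  "uspanning T G \<longleftrightarrow> usubgraph T G \<and> uverts T = uverts G"

text \<open>A walk is given by its list of vertices and its list of edges.\<close>

definition uwalk :: "('a, 'e) ugraph \<Rightarrow> 'a list \<Rightarrow> 'e list \<Rightarrow> bool" where
  "uwalk G vs es \<longleftrightarrow> length vs = Suc (length es) \<and>
     set vs \<subseteq> uverts G \<and> set es \<subseteq> uedges G \<and>
     (\<forall>i<length es. uends G (es ! i) = {vs ! i, vs ! Suc i})"

definition upath :: "('a, 'e) ugraph \<Rightarrow> 'a list \<Rightarrow> 'e list \<Rightarrow> bool" where
  "upath G vs es \<longleftrightarrow> uwalk G vs es \<and> distinct vs"

text \<open>Distinctness of the edges excludes going back along the same edge, but allows a cycle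
  that consists of two parallel edges.\<close>

definition ucycle :: "('a, 'e) ugraph \<Rightarrow> 'a list \<Rightarrow> 'e list \<Rightarrow> bool" where
  "ucycle G vs es \<longleftrightarrow> uwalk G vs es \<and> es \<noteq> [] \<and> hd vs = last vs \<and>
     distinct (tl vs) \<and> distinct es"

definition uconnected :: "('a, 'e) ugraph \<Rightarrow> bool" where
  "uconnected G \<longleftrightarrow> uverts G \<noteq> {} \<and>
     (\<forall>u\<in>uverts G. \<forall>v\<in>uverts G. \<exists>vs es. uwalk G vs es \<and> hd vs = u \<and> last vs = v)"

definition utree :: "('a, 'e) ugraph \<Rightarrow> bool" where
  "utree G \<longleftrightarrow> wf_ugraph G \<and> uconnected G \<and> (\<nexists>vs es. ucycle G vs es)"

definition uspanning_tree :: "('a, 'e) ugraph \<Rightarrow> ('a, 'e) ugraph \<Rightarrow> bool" where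
  "uspanning_tree T G \<longleftrightarrow> uspanning T G \<and> utree T"

definition independent_set :: "('a, 'e) ugraph \<Rightarrow> 'a set \<Rightarrow> bool" where
  "independent_set G S \<longleftrightarrow> S \<subseteq> uverts G \<and> (\<forall>e\<in>uedges G. \<not> uends G e \<subseteq> S)"

definition maximal_independent_set :: "('a, 'e) ugraph \<Rightarrow> 'a set \<Rightarrow> bool" where
  "maximal_independent_set G S \<longleftrightarrow> independent_set G S \<and>
     (\<forall>S'. independent_set G S' \<and> S \<subseteq> S' \<longrightarrow> S' = S)"


section \<open>Conflicts and projectivity, undirected case\<close>

text \<open>
  The interval has to be taken in the reals: the integer points of \<open>(1,3)\<close> and of \<open>(2,4)\<close> are
  disjoint, although edges with these end vertices are in conflict.
\<close>

definition edge_interval :: "(nat, 'e) ugraph \<Rightarrow> 'e \<Rightarrow> real set" where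
  "edge_interval G e = {real (Min (uends G e)) <..< real (Max (uends G e))}"

definition conflict :: "(nat, 'e) ugraph \<Rightarrow> 'e \<Rightarrow> 'e \<Rightarrow> bool" where
  "conflict G e f \<longleftrightarrow>
     edge_interval G e \<inter> edge_interval G f \<noteq> {} \<and>
     edge_interval G e \<inter> edge_interval G f \<noteq> edge_interval G e \<and>
     edge_interval G e \<inter> edge_interval G f \<noteq> edge_interval G f"

lemma conflict_iff:
  fixes G :: "(nat, 'e) ugraph"
  defines "lo \<equiv> \<lambda>e. Min (uends G e)" and "hi \<equiv> \<lambda>e. Max (uends G e)"
  assumes "lo e < hi e" and "lo f < hi f"
  shows "conflict G e f \<longleftrightarrow>
    lo e < lo f \<and> lo f < hi e \<and> hi e < hi f \<or> lo f < lo e \<and> lo e < hi f \<and> hi f < hi e"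
proof -
  have *: "real (lo e) < real (hi e)" "real (lo f) < real (hi f)"
    using assms(3,4) by simp_all
  have I: "edge_interval G x = {real (lo x) <..< real (hi x)}" for x
    by (simp add: edge_interval_def lo_def hi_def)
  show ?thesis
    unfolding conflict_def I Int_greaterThanLessThan
    using * by (auto simp: greaterThanLessThan_eq_iff max_def min_def split: if_splits)
qed

definition conflict_graph :: "(nat, 'e) ugraph \<Rightarrow> ('e, 'e set) ugraph" where
  "conflict_graph G =
     \<lparr> uverts = uedges G,
       uedges = {{e, f} | e f. e \<in> uedges G \<and> f \<in> uedges G \<and> conflict G e f},
       uends = (\<lambda>p. p) \<rparr>"

definition projective :: "(nat, 'e) ugraph \<Rightarrow> bool" where
  "projective T \<longleftrightarrow> (\<forall>e\<in>uedges T. \<forall>f\<in>uedges T. \<not> conflict T e f)"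

definition maximal_projective_subgraph :: "(nat, 'e) ugraph \<Rightarrow> (nat, 'e) ugraph \<Rightarrow> bool" where
  "maximal_projective_subgraph T G \<longleftrightarrow>
     usubgraph T G \<and> uverts T = uverts G \<and>
     projective T \<and>
     (\<forall>e\<in>uedges G - uedges T. \<exists>f\<in>uedges T. conflict G e f)"

definition projective_spanning_tree :: "(nat, 'e) ugraph \<Rightarrow> (nat, 'e) ugraph \<Rightarrow> bool" where
  "projective_spanning_tree T G \<longleftrightarrow> uspanning_tree T G \<and> projective T"


section \<open>The directed case\<close>

definition underlying :: "('a, 'b) pre_digraph \<Rightarrow> ('a, 'b) ugraph" where
  "underlying D = \<lparr> uverts = verts D, uedges = arcs D, uends = (\<lambda>e. {tail D e, head D e}) \<rparr>"

definition maximal_projective_subdigraph ::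
    "(nat, 'b) pre_digraph \<Rightarrow> (nat, 'b) pre_digraph \<Rightarrow> bool" where
  "maximal_projective_subdigraph T D \<longleftrightarrow>
     subgraph T D \<and> verts T = verts D \<and>
     projective (underlying T) \<and>
     (\<forall>e\<in>arcs D - arcs T. \<exists>f\<in>arcs T. conflict (underlying D) e f)"

text \<open>A spanning tree of a digraph, ignoring the directions of the arcs.\<close>

definition dspanning_tree :: "('a, 'b) pre_digraph \<Rightarrow> ('a, 'b) pre_digraph \<Rightarrow> bool" where
  "dspanning_tree T D \<longleftrightarrow> spanning T D \<and> utree (underlying T)"

text \<open>All arcs point away from \<open>r\<close>: every path that starts at \<open>r\<close>, in the underlying
  undirected graph, traverses its arcs from tail to head.\<close>

definition oriented_away :: "('a, 'b) pre_digraph \<Rightarrow> 'a \<Rightarrow> bool" where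
  "oriented_away T r \<longleftrightarrow>
     (\<forall>vs es. upath (underlying T) vs es \<and> hd vs = r \<longrightarrow>
        (\<forall>i<length es. tail T (es ! i) = vs ! i \<and> head T (es ! i) = vs ! Suc i))"

definition rooted_spanning_tree ::
    "'a \<Rightarrow> ('a, 'b) pre_digraph \<Rightarrow> ('a, 'b) pre_digraph \<Rightarrow> bool" where
  "rooted_spanning_tree r T D \<longleftrightarrow>
     spanning T D \<and> utree (underlying T) \<and> r \<in> verts T \<and> oriented_away T r"

definition projective_dspanning_tree ::
    "(nat, 'b) pre_digraph \<Rightarrow> (nat, 'b) pre_digraph \<Rightarrow> bool" where
  "projective_dspanning_tree T D \<longleftrightarrow> dspanning_tree T D \<and> projective (underlying T)"

definition projective_rooted_spanning_tree ::
    "nat \<Rightarrow> (nat, 'b) pre_digraph \<Rightarrow> (nat, 'b) pre_digraph \<Rightarrow> bool" where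
  "projective_rooted_spanning_tree r T D \<longleftrightarrow>
     rooted_spanning_tree r T D \<and> projective (underlying T)"

end

theory Submission
  imports Defs
begin

text \<open>In \<open>conflict_graph G\<close>, projectivity says that the edges of a subgraph are
  independent, and clause (c) says that every other vertex has a neighbour among them. An
  independent set is maximal exactly when it dominates its complement
  (\<open>maximal_independent_set_conflict_graph_iff\<close>), which gives (i). For (ii), being a
  tree, or a tree oriented away from \<open>r\<close>, is a condition on \<open>T\<close> alone. So
  it suffices to show that \<open>T\<close> is a projective spanning subgraph iff it is a spanning
  subgraph of some maximal projective one (\<open>uspanning_projective_iff\<close>,
  \<open>spanning_projective_iff\<close>). One direction holds because subsets of independent sets
  are independent; for the other, finiteness lets the edge set of \<open>T\<close> grow to a maximal
  independent set, and the graph with these edges is the required one. Conflicts ignore directions,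
  so the directed case takes its arc set from the underlying graph.\<close>

lemma conflict_sym: "conflict G e f \<longleftrightarrow> conflict G f e"
  by (auto simp: conflict_def Int_commute)

lemma not_conflict_self: "\<not> conflict G e e"
  by (simp add: conflict_def)

lemma conflict_cong:
  assumes "uends T = uends G"
  shows "conflict T = conflict G"
  using assms by (simp add: conflict_def edge_interval_def fun_eq_iff)

text \<open>Since \<open>uends\<close> of the conflict graph is the identity, an edge of it inside
  \<open>S\<close> is just a conflicting pair of members of \<open>S\<close>.\<close>

lemma independent_set_conflict_graph_iff:
  "independent_set (conflict_graph G) S \<longleftrightarrow>
     S \<subseteq> uedges G \<and> (\<forall>e\<in>S. \<forall>f\<in>S. \<not> conflict G e f)"
  unfolding independent_set_def conflict_graph_def by auto blast

text \<open>A single vertex can be added to an independent set iff it has no neighbour there; this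
  turns maximality under inclusion into clause (c).\<close>

lemma maximal_independent_set_conflict_graph_iff:
  "maximal_independent_set (conflict_graph G) S \<longleftrightarrow>
     independent_set (conflict_graph G) S \<and>
     (\<forall>e\<in>uedges G - S. \<exists>f\<in>S. conflict G e f)"
  (is "?max \<longleftrightarrow> ?ind \<and> ?dom")
proof (intro iffI conjI)
  assume max: ?max
  then show ind: ?ind
    by (simp add: maximal_independent_set_def)
  show ?dom
  proof (rule ccontr)
    assume "\<not> ?dom"
    then obtain e where e: "e \<in> uedges G" "e \<notin> S" "\<forall>f\<in>S. \<not> conflict G e f"
      by blast
    \<comment> \<open>The new pairs are \<open>e\<close> with itself and \<open>e\<close> with
      members of \<open>S\<close> in either order, hence the need for irreflexivity and
      symmetry.\<close>
    then have "independent_set (conflict_graph G) (insert e S)"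
      using ind by (auto simp: independent_set_conflict_graph_iff not_conflict_self conflict_sym)
    then show False
      using max e(2) unfolding maximal_independent_set_def by blast
  qed
next
  assume "?ind \<and> ?dom"
  then show ?max
    \<comment> \<open>A member of a larger independent set outside \<open>S\<close> would conflict
      with some member of \<open>S\<close>, which the larger set also contains.\<close>
    unfolding maximal_independent_set_def independent_set_conflict_graph_iff by blast
qed

text \<open>The independent sets lie in the power set of a finite set, so among those above
  \<open>S\<close> one is maximal.\<close>

lemma independent_set_extend_maximal:
  assumes "finite (uverts H)" and "independent_set H S"
  obtains S' where "S \<subseteq> S'" and "maximal_independent_set H S'"
proof -
  have "finite {S. independent_set H S}"
    using assms(1) by (rule finite_subset[rotated, OF finite_Pow_iff[THEN iffD2]])
      (auto simp: independent_set_def)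
  from finite_has_maximal2[OF this, of S] assms(2)
  obtain S' where "independent_set H S'" "S \<subseteq> S'"
    "\<forall>S''. independent_set H S'' \<longrightarrow> S' \<subseteq> S'' \<longrightarrow> S' = S''"
    by auto
  then show thesis
    by (intro that[of S']) (auto simp: maximal_independent_set_def)
qed

text \<open>A subgraph has the end-vertex function of \<open>G\<close>, so conflicts in
  \<open>T\<close> and in \<open>G\<close> are the same relation.\<close>

lemma projective_iff_independent_set:
  assumes "usubgraph T G"
  shows "projective T \<longleftrightarrow> independent_set (conflict_graph G) (uedges T)"
  using assms conflict_cong[of T G]
  by (auto simp: usubgraph_def projective_def independent_set_conflict_graph_iff)

lemma projective_usubgraph:
  assumes "usubgraph T M" and "projective M"
  shows "projective T"
  using assms conflict_cong[of T M] by (auto simp: usubgraph_def projective_def)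

lemma maximal_projective_subgraph_iff:
  "maximal_projective_subgraph T G \<longleftrightarrow>
     uspanning T G \<and> maximal_independent_set (conflict_graph G) (uedges T)"
  unfolding maximal_projective_subgraph_def uspanning_def
    maximal_independent_set_conflict_graph_iff
  using projective_iff_independent_set[of T G] by blast

lemma uspanning_trans:
  assumes "uspanning T M" and "uspanning M G"
  shows "uspanning T G"
  using assms by (auto simp: uspanning_def usubgraph_def)

text \<open>Only an edge set is produced, not a graph, so that it can be turned into a subgraph or,
  in the directed case, into a subdigraph.\<close>

lemma projective_extend_maximal:
  assumes "uspanning T G" and "finite (uedges G)" and "projective T"
  obtains S where "uedges T \<subseteq> S" and "S \<subseteq> uedges G"
    and "maximal_independent_set (conflict_graph G) S"
proof -
  have "independent_set (conflict_graph G) (uedges T)"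
    using assms(1,3) projective_iff_independent_set unfolding uspanning_def by blast
  moreover have "finite (uverts (conflict_graph G))"
    using assms(2) by (simp add: conflict_graph_def)
  ultimately obtain S where "uedges T \<subseteq> S" "maximal_independent_set (conflict_graph G) S"
    by (metis independent_set_extend_maximal)
  then show thesis
    by (intro that[of S])
      (auto simp: maximal_independent_set_def independent_set_conflict_graph_iff)
qed

lemma uspanning_projective_iff:
  assumes "finite (uedges G)"
  shows "uspanning T G \<and> projective T \<longleftrightarrow>
    (\<exists>M. maximal_projective_subgraph M G \<and> uspanning T M)"
proof
  assume T: "uspanning T G \<and> projective T"
  then obtain S where S: "uedges T \<subseteq> S" "S \<subseteq> uedges G"
    "maximal_independent_set (conflict_graph G) S"
    using assms projective_extend_maximal by metis
  \<comment> \<open>Keeping the vertices and end-vertex function of \<open>G\<close> makes this a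
    spanning subgraph of \<open>G\<close> that has \<open>T\<close> as a spanning subgraph.\<close>
  let ?M = "G\<lparr>uedges := S\<rparr>"
  have "wf_ugraph ?M"
    using T S(2) by (auto simp: uspanning_def usubgraph_def wf_ugraph_def)
  then have "maximal_projective_subgraph ?M G \<and> uspanning T ?M"
    using T S by (auto simp: maximal_projective_subgraph_iff uspanning_def usubgraph_def)
  then show "\<exists>M. maximal_projective_subgraph M G \<and> uspanning T M" ..
next
  assume "\<exists>M. maximal_projective_subgraph M G \<and> uspanning T M"
  then obtain M where "maximal_projective_subgraph M G" "uspanning T M"
    by blast
  then show "uspanning T G \<and> projective T"
    using uspanning_trans[of T M G] projective_usubgraph[of T M]
    unfolding maximal_projective_subgraph_def uspanning_def by blast
qed

lemma underlying_simps [simp]: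
  "uverts (underlying D) = verts D"
  "uedges (underlying D) = arcs D"
  "uends (underlying D) e = {tail D e, head D e}"
  by (simp_all add: underlying_def)

lemma wf_ugraph_underlying:
  assumes "wf_digraph D"
  shows "wf_ugraph (underlying D)"
  using assms by (auto simp: wf_ugraph_def wf_digraph_def card_insert_if)

text \<open>Compatibility of digraphs means equal tail and head functions, hence equal
  \<open>uends\<close>.\<close>

lemma usubgraph_underlying:
  assumes "subgraph T D"
  shows "usubgraph (underlying T) (underlying D)"
  using assms
  by (auto simp: subgraph_def usubgraph_def compatible_def wf_ugraph_underlying fun_eq_iff)

lemma uspanning_underlying:
  assumes "spanning T D"
  shows "uspanning (underlying T) (underlying D)"
  using assms by (simp add: spanning_def uspanning_def usubgraph_underlying)

text \<open>The conjunct \<open>spanning T D\<close> has to be kept: the underlying graphs do not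
  record whether arcs have the same direction in \<open>T\<close> and \<open>D\<close>.\<close>

lemma maximal_projective_subdigraph_iff:
  "maximal_projective_subdigraph T D \<longleftrightarrow>
     spanning T D \<and> maximal_projective_subgraph (underlying T) (underlying D)"
  by (auto simp: maximal_projective_subdigraph_def maximal_projective_subgraph_def spanning_def
      usubgraph_underlying)

lemma spanning_trans:
  assumes "spanning T M" and "spanning M D"
  shows "spanning T D"
  using assms by (auto simp: spanning_def intro: subgraph_trans)

lemma spanning_projective_iff:
  assumes "finite (arcs D)"
  shows "spanning T D \<and> projective (underlying T) \<longleftrightarrow>
    (\<exists>M. maximal_projective_subdigraph M D \<and> spanning T M)"
proof
  assume T: "spanning T D \<and> projective (underlying T)"
  have "\<exists>S. arcs T \<subseteq> S \<and> S \<subseteq> arcs D \<and>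
      maximal_independent_set (conflict_graph (underlying D)) S"
    using projective_extend_maximal[of "underlying T" "underlying D"] T assms
    by (metis underlying_simps(2) uspanning_underlying)
  then obtain S where S: "arcs T \<subseteq> S" "S \<subseteq> arcs D"
    "maximal_independent_set (conflict_graph (underlying D)) S"
    by blast
  \<comment> \<open>The independent set comes from the underlying graph, but the witness must be a
    digraph; it inherits the directions of \<open>D\<close>, which are also those of
    \<open>T\<close>.\<close>
  let ?M = "D\<lparr>arcs := S\<rparr>"
  have "wf_digraph ?M"
    using T S(2) by (auto simp: spanning_def subgraph_def wf_digraph_def)
  then have "spanning ?M D" "spanning T ?M"
    using T S by (auto simp: spanning_def subgraph_def compatible_def)
  then have "maximal_projective_subdigraph ?M D \<and> spanning T ?M"
    using S(3) uspanning_underlying[of ?M D]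
    by (simp add: maximal_projective_subdigraph_iff maximal_projective_subgraph_iff)
  then show "\<exists>M. maximal_projective_subdigraph M D \<and> spanning T M" ..
next
  assume "\<exists>M. maximal_projective_subdigraph M D \<and> spanning T M"
  then obtain M where M: "maximal_projective_subdigraph M D" "spanning T M"
    by blast
  then have "projective (underlying T)"
    using projective_usubgraph usubgraph_underlying
    unfolding maximal_projective_subdigraph_def spanning_def by blast
  then show "spanning T D \<and> projective (underlying T)"
    using M spanning_trans by (auto simp: maximal_projective_subdigraph_iff)
qed

theorem mainTheorem1:
  fixes n :: nat
    and G :: "(nat, 'e) ugraph"
    and D :: "(nat, 'b) pre_digraph"
  shows
    "(finite_ugraph G \<and> loopless_ugraph G \<and> uverts G = {1..n} \<longrightarrow>
        (\<forall>T. usubgraph T G \<and> uverts T = {1..n} \<longrightarrow>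
           (maximal_projective_subgraph T G \<longleftrightarrow>
            maximal_independent_set (conflict_graph G) (uedges T))) \<and>
        (\<forall>T. projective_spanning_tree T G \<longleftrightarrow>
           (\<exists>M. maximal_projective_subgraph M G \<and> uspanning_tree T M)))
     \<and>
     (fin_digraph D \<and> loopfree_digraph D \<and> verts D = {1..n} \<longrightarrow>
        (\<forall>T. subgraph T D \<and> verts T = {1..n} \<longrightarrow>
           (maximal_projective_subdigraph T D \<longleftrightarrow>
            maximal_independent_set (conflict_graph (underlying D)) (arcs T))) \<and>
        (\<forall>T. projective_dspanning_tree T D \<longleftrightarrow>
           (\<exists>M. maximal_projective_subdigraph M D \<and> dspanning_tree T M)) \<and>
        (\<forall>r\<in>{1..n}. \<forall>T. projective_rooted_spanning_tree r T D \<longleftrightarrow>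
           (\<exists>M. maximal_projective_subdigraph M D \<and> rooted_spanning_tree r T M)))"
proof (intro conjI impI allI ballI)
  fix T
  assume "finite_ugraph G \<and> loopless_ugraph G \<and> uverts G = {1..n}"
    and "usubgraph T G \<and> uverts T = {1..n}"
  then show "maximal_projective_subgraph T G \<longleftrightarrow>
      maximal_independent_set (conflict_graph G) (uedges T)"
    by (simp add: maximal_projective_subgraph_iff uspanning_def)
next
  fix T
  assume "finite_ugraph G \<and> loopless_ugraph G \<and> uverts G = {1..n}"
  then have "finite (uedges G)"
    by (simp add: finite_ugraph_def)
  \<comment> \<open>The conjunct \<open>utree T\<close> mentions neither \<open>G\<close> nor
    \<open>M\<close>, so it can be added to both sides of this equivalence.\<close>
  from uspanning_projective_iff[OF this, of T]
  show "projective_spanning_tree T G \<longleftrightarrow>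
      (\<exists>M. maximal_projective_subgraph M G \<and> uspanning_tree T M)"
    unfolding projective_spanning_tree_def uspanning_tree_def by blast
next
  fix T
  assume "fin_digraph D \<and> loopfree_digraph D \<and> verts D = {1..n}"
    and "subgraph T D \<and> verts T = {1..n}"
  then show "maximal_projective_subdigraph T D \<longleftrightarrow>
      maximal_independent_set (conflict_graph (underlying D)) (arcs T)"
    by (simp add: maximal_projective_subdigraph_iff maximal_projective_subgraph_iff
        spanning_def uspanning_def usubgraph_underlying)
next
  fix T
  assume "fin_digraph D \<and> loopfree_digraph D \<and> verts D = {1..n}"
  then have "finite (arcs D)"
    by (simp add: fin_digraph.finite_arcs)
  from spanning_projective_iff[OF this, of T]
  show "projective_dspanning_tree T D \<longleftrightarrow>
      (\<exists>M. maximal_projective_subdigraph M D \<and> dspanning_tree T M)"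
    unfolding projective_dspanning_tree_def dspanning_tree_def by blast
next
  fix r T
  assume "fin_digraph D \<and> loopfree_digraph D \<and> verts D = {1..n}"
  then have "finite (arcs D)"
    by (simp add: fin_digraph.finite_arcs)
  \<comment> \<open>The tree condition, \<open>r \<in> verts T\<close> and
    \<open>oriented_away T r\<close> all concern \<open>T\<close> alone and pass through the
    quantifier over \<open>M\<close>.\<close>
  from spanning_projective_iff[OF this, of T]
  show "projective_rooted_spanning_tree r T D \<longleftrightarrow>
      (\<exists>M. maximal_projective_subdigraph M D \<and> rooted_spanning_tree r T M)"
    unfolding projective_rooted_spanning_tree_def rooted_spanning_tree_def by blast
qed

end
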